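(* The Euler polynomial $G\mapsto e_G(t)=\sum_{k\ge0}v_k(G)t^k$ extends to a ring homomorphism from the strong ring to the polynomial ring $\mathbb{Z}[t]$.
   Context: A finite abstract simplicial complex is a finite set of finite non-empty sets which is closed under taking non-empty subsets; $\dim(x)=|x|-1$. A product complex is a finite Cartesian product $G_1\times\cdots\times G_n$ ($n\ge 1$) of finite abstract simplicial complexes; its cells are the sets $x=x_1\times\cdots\times x_n$ with $x_i\in G_i$, with $\dim(x)=\sum_i\dim(x_i)$. Two product complexes are isomorphic if there is a bijection between their cells preserving inclusion in both directions. A signed complex is a finite formal disjoint union of product complexes, each summand carrying a sign in $\{1,-1\}$. Addition is disjoint union, $-G$ reverses all signs, and products are taken term by term with signs multiplied. The strong ring is the commutative ring of signed complexes modulo isomorphism of summands, splitting of summands into connected components (with the same sign), and cancellation of $G\oplus(-G)$; its zero is the empty complex and its one is the one-point complex $K_1$. For a product complex $G$, $v_k(G)$ is the number of $k$-dimensional cells of $G$ (so $(v_0,v_1,\dots)$ is the $f$-vector). For a signed complex with summands $G_i$ and signs $\varepsilon_i$, $v_k(G)=\sum_i\varepsilon_iv_k(G_i)$; thus $e_{-G}=-e_G$. *)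

theory Defs
  imports "HOL-Computational_Algebra.Polynomial" "HOL-Library.Multiset"
begin

section \<open>Product complexes\<close>

definition simplicial_complex :: "'v set set \<Rightarrow> bool" where
  "simplicial_complex G \<longleftrightarrow>
     finite G \<and> (\<forall>x\<in>G. finite x \<and> x \<noteq> {}) \<and> (\<forall>x\<in>G. \<forall>y. y \<subseteq> x \<and> y \<noteq> {} \<longrightarrow> y \<in> G)"

definition simplex_dim :: "'v set \<Rightarrow> nat" where
  "simplex_dim x = card x - 1"

text \<open>
  The product \<open>G\<^sub>1 \<times> \<dots> \<times> G\<^sub>n\<close> is represented by the list \<open>[G\<^sub>1, \<dots>, G\<^sub>n]\<close> of its factors.
  For a list \<open>xs = [x\<^sub>1, \<dots>, x\<^sub>n]\<close> of simplices, \<open>listset xs\<close> is the Cartesian product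
  \<open>x\<^sub>1 \<times> \<dots> \<times> x\<^sub>n\<close>, with tuples encoded as lists of vertices.
\<close>

definition product_complex :: "'v set set list \<Rightarrow> bool" where
  "product_complex Gs \<longleftrightarrow> Gs \<noteq> [] \<and> (\<forall>G\<in>set Gs. simplicial_complex G)"

definition cells :: "'v set set list \<Rightarrow> 'v list set set" where
  "cells Gs = {listset xs | xs. xs \<in> listset Gs}"

text \<open>
  Since simplices are non-empty, a cell \<open>x\<^sub>1 \<times> \<dots> \<times> x\<^sub>n\<close> determines the factors \<open>x\<^sub>i\<close>, so
  each cell is counted below under exactly one dimension.
\<close>

definition face_number :: "'v set set list \<Rightarrow> nat \<Rightarrow> nat" where
  "face_number Gs k = card {listset xs | xs. xs \<in> listset Gs \<and> (\<Sum>x\<leftarrow>xs. simplex_dim x) = k}"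

definition isomorphic_complexes :: "'v set set list \<Rightarrow> 'v set set list \<Rightarrow> bool" where
  "isomorphic_complexes Gs Hs \<longleftrightarrow>
     (\<exists>f. bij_betw f (cells Gs) (cells Hs) \<and>
          (\<forall>x\<in>cells Gs. \<forall>y\<in>cells Gs. x \<subseteq> y \<longleftrightarrow> f x \<subseteq> f y))"

definition incident :: "'c set set \<Rightarrow> ('c set \<times> 'c set) set" where
  "incident P = {(x, y). x \<in> P \<and> y \<in> P \<and> (x \<subseteq> y \<or> y \<subseteq> x)}"

definition components :: "'c set set \<Rightarrow> 'c set set set" where
  "components P = P // (incident P)\<^sup>*"


section \<open>Signed complexes\<close>

type_synonym 'v signed = "(int \<times> 'v set set list) multiset"

definition signed_complex :: "'v signed \<Rightarrow> bool" where
  "signed_complex X \<longleftrightarrow> (\<forall>(s, G)\<in>#X. s \<in> {1, -1} \<and> product_complex G)"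

definition signed_neg :: "'v signed \<Rightarrow> 'v signed" where
  "signed_neg X = {#(- s, G). (s, G) \<in># X#}"

definition signed_times :: "'v signed \<Rightarrow> 'v signed \<Rightarrow> 'v signed" where
  "signed_times X Y = (\<Sum>(s, G)\<in>#X. {#(s * t, G @ H). (t, H) \<in># Y#})"

definition signed_face_number :: "'v signed \<Rightarrow> nat \<Rightarrow> int" where
  "signed_face_number X k = (\<Sum>(s, G)\<in>#X. s * int (face_number G k))"

text \<open>The index set is finite for every signed complex, since complexes are finite.\<close>

definition euler_poly :: "'v signed \<Rightarrow> int poly" where
  "euler_poly X = (\<Sum>k | signed_face_number X k \<noteq> 0. monom (signed_face_number X k) k)"

text \<open>
  In the rule \<open>split\<close>, every connected component of \<open>G\<close>, as a set of cells, is the cell set of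
  exactly one product complex in \<open>Hs\<close>. An empty product has no components and becomes \<open>{#}\<close>.
\<close>

inductive strong_eq :: "'v signed \<Rightarrow> 'v signed \<Rightarrow> bool" where
  refl: "signed_complex X \<Longrightarrow> strong_eq X X"
| sym: "strong_eq X Y \<Longrightarrow> strong_eq Y X"
| trans: "strong_eq X Y \<Longrightarrow> strong_eq Y Z \<Longrightarrow> strong_eq X Z"
| add: "strong_eq X Y \<Longrightarrow> signed_complex Z \<Longrightarrow> strong_eq (X + Z) (Y + Z)"
| iso: "s \<in> {1, -1} \<Longrightarrow> product_complex G \<Longrightarrow> product_complex H \<Longrightarrow>
    isomorphic_complexes G H \<Longrightarrow> strong_eq {#(s, G)#} {#(s, H)#}"
| split: "s \<in> {1, -1} \<Longrightarrow> product_complex G \<Longrightarrow> \<forall>H\<in>Hs. product_complex H \<Longrightarrow>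
    bij_betw cells Hs (components (cells G)) \<Longrightarrow> strong_eq {#(s, G)#} (\<Sum>H\<in>Hs. {#(s, H)#})"
| cancel: "signed_complex X \<Longrightarrow> strong_eq (X + signed_neg X) {#}"


section \<open>Cells of products\<close>

definition cell_times :: "'v list set \<Rightarrow> 'v list set \<Rightarrow> 'v list set" where
  "cell_times c d = {xs @ ys | xs ys. xs \<in> c \<and> ys \<in> d}"

lemma listset_iff: "xs \<in> listset As \<longleftrightarrow> list_all2 (\<in>) xs As"
  by (induction As arbitrary: xs) (auto simp: set_Cons_def list_all2_Cons2)

lemma listset_append: "listset (As @ Bs) = {xs @ ys | xs ys. xs \<in> listset As \<and> ys \<in> listset Bs}"
proof -
  have "zs \<in> listset (As @ Bs) \<longleftrightarrow> (\<exists>xs ys. zs = xs @ ys \<and> xs \<in> listset As \<and> ys \<in> listset Bs)" for zs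
    unfolding listset_iff list_all2_append2 using list_all2_lengthD by metis
  then show ?thesis by (simp add: set_eq_iff)
qed

lemma finite_listset: "\<forall>A\<in>set As. finite A \<Longrightarrow> finite (listset As)"
proof (induction As)
  case (Cons A As)
  have "set_Cons A (listset As) = (\<lambda>(x, xs). x # xs) ` (A \<times> listset As)"
    by (auto simp: set_Cons_def)
  with Cons show ?case by simp
qed simp

lemma listset_append_cell_times: "listset (xs @ ys) = cell_times (listset xs) (listset ys)"
  by (simp only: listset_append cell_times_def)

lemma cells_append: "cells (G @ H) = {cell_times c d | c d. c \<in> cells G \<and> d \<in> cells H}"
proof -
  have "cells (G @ H) = listset ` {xs @ ys | xs ys. xs \<in> listset G \<and> ys \<in> listset H}"
    unfolding cells_def listset_append[of G H] by (simp only: setcompr_eq_image Collect_mem_eq)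
  also have "\<dots> = {cell_times (listset xs) (listset ys) | xs ys. xs \<in> listset G \<and> ys \<in> listset H}"
    unfolding listset_append_cell_times[symmetric] by blast
  also have "\<dots> = {cell_times c d | c d. c \<in> cells G \<and> d \<in> cells H}"
    unfolding cells_def by blast
  finally show ?thesis .
qed

lemma product_complex_append:
  "product_complex G \<Longrightarrow> product_complex H \<Longrightarrow> product_complex (G @ H)"
  by (auto simp: product_complex_def)

lemma finite_cells: "product_complex G \<Longrightarrow> finite (cells G)"
  using finite_listset[of G]
  by (auto simp: cells_def product_complex_def simplicial_complex_def)

lemma finite_face_number:
  assumes "product_complex G"
  shows "finite {k. face_number G k \<noteq> 0}"
proof -
  have "finite (listset G)"
    using finite_listset[of G] assms by (auto simp: product_complex_def simplicial_complex_def)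
  moreover have "{k. face_number G k \<noteq> 0} \<subseteq> (\<lambda>xs. \<Sum>x\<leftarrow>xs. simplex_dim x) ` listset G"
  proof
    fix k assume "k \<in> {k. face_number G k \<noteq> 0}"
    then have "{listset xs | xs. xs \<in> listset G \<and> (\<Sum>x\<leftarrow>xs. simplex_dim x) = k} \<noteq> {}"
      unfolding face_number_def mem_Collect_eq by (metis card.empty)
    then show "k \<in> (\<lambda>xs. \<Sum>x\<leftarrow>xs. simplex_dim x) ` listset G" by blast
  qed
  ultimately show ?thesis by (rule finite_surj)
qed

lemma finite_signed_face_number:
  "signed_complex X \<Longrightarrow> finite {k. signed_face_number X k \<noteq> 0}"
proof (induction X)
  case empty
  then show ?case by (simp add: signed_face_number_def)
next
  case (add x X)
  obtain s G where x: "x = (s, G)" by (cases x)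
  with add.prems have G: "product_complex G" and X: "signed_complex X"
    by (auto simp: signed_complex_def)
  have "{k. signed_face_number (add_mset x X) k \<noteq> 0} \<subseteq>
      {k. face_number G k \<noteq> 0} \<union> {k. signed_face_number X k \<noteq> 0}"
    by (auto simp: x signed_face_number_def)
  then show ?case
    using finite_face_number[OF G] add.IH[OF X] by (meson finite_UnI finite_subset)
qed

lemma coeff_euler_poly:
  assumes "signed_complex X"
  shows "coeff (euler_poly X) k = signed_face_number X k"
  using finite_signed_face_number[OF assms]
  by (simp add: euler_poly_def coeff_sum)

lemma cell_nonempty:
  assumes "product_complex G" "c \<in> cells G"
  shows "c \<noteq> {}"
proof -
  obtain xs where xs: "c = listset xs" "list_all2 (\<in>) xs G"
    using assms(2) unfolding cells_def listset_iff by blast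
  have "\<exists>A\<in>set G. x \<in> A" if "x \<in> set xs" for x
    using xs(2) that by (metis in_set_conv_nth list_all2_conv_all_nth nth_mem)
  then have "\<forall>x\<in>set xs. x \<noteq> {}"
    using assms(1) unfolding product_complex_def simplicial_complex_def by blast
  then have "list_all2 (\<in>) (map (\<lambda>x. SOME a. a \<in> x) xs) xs"
    by (auto simp: list_all2_conv_all_nth some_in_eq)
  then have "map (\<lambda>x. SOME a. a \<in> x) xs \<in> c"
    by (simp only: xs(1) listset_iff)
  then show ?thesis by blast
qed

lemma cell_length: "c \<in> cells G \<Longrightarrow> xs \<in> c \<Longrightarrow> length xs = length G"
  by (auto simp: cells_def listset_iff dest!: list_all2_lengthD)

lemma cell_times_subset_iff:
  assumes "product_complex G" "product_complex H"
    and "c \<in> cells G" "d \<in> cells H" "c' \<in> cells G" "d' \<in> cells H"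
  shows "cell_times c d \<subseteq> cell_times c' d' \<longleftrightarrow> c \<subseteq> c' \<and> d \<subseteq> d'"
proof
  assume sub: "cell_times c d \<subseteq> cell_times c' d'"
  obtain x0 y0 where x0: "x0 \<in> c" "y0 \<in> d"
    using cell_nonempty assms by blast
  have "xs \<in> c' \<and> ys \<in> d'" if "xs \<in> c" "ys \<in> d" for xs ys
  proof -
    have "xs @ ys \<in> cell_times c' d'"
      using sub that unfolding cell_times_def by blast
    then obtain xs' ys' where "xs @ ys = xs' @ ys'" "xs' \<in> c'" "ys' \<in> d'"
      by (auto simp: cell_times_def)
    moreover have "length xs = length xs'"
      using cell_length assms that calculation by metis
    ultimately show ?thesis by simp
  qed
  with x0 show "c \<subseteq> c' \<and> d \<subseteq> d'" by blast
next
  assume "c \<subseteq> c' \<and> d \<subseteq> d'"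
  then show "cell_times c d \<subseteq> cell_times c' d'"
    unfolding cell_times_def by blast
qed

lemma cell_times_eq_iff:
  assumes "product_complex G" "product_complex H"
    and "c \<in> cells G" "d \<in> cells H" "c' \<in> cells G" "d' \<in> cells H"
  shows "cell_times c d = cell_times c' d' \<longleftrightarrow> c = c' \<and> d = d'"
  using cell_times_subset_iff[OF assms(1,2,3,4,5,6)] cell_times_subset_iff[OF assms(1,2,5,6,3,4)]
  by blast


section \<open>Isomorphisms of products\<close>

lemma isomorphic_complexesI:
  assumes p: "p ` I = cells G" and q: "q ` I = cells H"
    and le: "\<And>i j. i \<in> I \<Longrightarrow> j \<in> I \<Longrightarrow> p i \<subseteq> p j \<longleftrightarrow> q i \<subseteq> q j"
  shows "isomorphic_complexes G H"
proof -
  define f where "f c = q (inv_into I p c)" for c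
  have f: "f (p i) = q i" if "i \<in> I" for i
  proof -
    have "p (inv_into I p (p i)) = p i" "inv_into I p (p i) \<in> I"
      using that by (auto simp: f_inv_into_f inv_into_into)
    then show ?thesis
      unfolding f_def using le that by (metis subset_antisym order_refl)
  qed
  have "f ` cells G = cells H"
    unfolding p[symmetric] q[symmetric] using f by (force simp: image_iff)
  moreover have le': "x \<subseteq> y \<longleftrightarrow> f x \<subseteq> f y" if "x \<in> cells G" "y \<in> cells G" for x y
    using that f le unfolding p[symmetric] by (metis imageE)
  moreover have "inj_on f (cells G)"
    by (intro inj_onI subset_antisym) (simp_all add: le')
  ultimately show ?thesis
    unfolding isomorphic_complexes_def bij_betw_def by (intro exI[of _ f]) simp
qed

lemma isomorphic_append_commute:
  assumes "product_complex G" "product_complex H"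
  shows "isomorphic_complexes (G @ H) (H @ G)"
proof (rule isomorphic_complexesI[where I = "cells G \<times> cells H"
      and p = "\<lambda>(c, d). cell_times c d" and q = "\<lambda>(c, d). cell_times d c"])
  fix i j assume "i \<in> cells G \<times> cells H" "j \<in> cells G \<times> cells H"
  then show "((case i of (c, d) \<Rightarrow> cell_times c d) \<subseteq> (case j of (c, d) \<Rightarrow> cell_times c d)) =
      ((case i of (c, d) \<Rightarrow> cell_times d c) \<subseteq> (case j of (c, d) \<Rightarrow> cell_times d c))"
    by (cases i; cases j)
      (simp add: cell_times_subset_iff[OF assms] cell_times_subset_iff[OF assms(2,1)] conj_commute)
qed (auto simp: cells_append image_iff)

lemma isomorphic_append_right:
  assumes "product_complex G" "product_complex G'" "product_complex H"
    and "isomorphic_complexes G G'"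
  shows "isomorphic_complexes (G @ H) (G' @ H)"
proof -
  from assms(4) obtain f where bij: "bij_betw f (cells G) (cells G')"
    and le: "\<forall>x\<in>cells G. \<forall>y\<in>cells G. x \<subseteq> y \<longleftrightarrow> f x \<subseteq> f y"
    unfolding isomorphic_complexes_def by (elim exE conjE)
  have f: "f ` cells G = cells G'"
    "\<And>x y. x \<in> cells G \<Longrightarrow> y \<in> cells G \<Longrightarrow> x \<subseteq> y \<longleftrightarrow> f x \<subseteq> f y"
    using bij by (simp add: bij_betw_def) (rule le[rule_format])
  show ?thesis
  proof (rule isomorphic_complexesI[where I = "cells G \<times> cells H"
        and p = "\<lambda>(c, d). cell_times c d" and q = "\<lambda>(c, d). cell_times (f c) d"])
    show "(\<lambda>(c, d). cell_times (f c) d) ` (cells G \<times> cells H) = cells (G' @ H)"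
      by (auto simp: cells_append f(1)[symmetric] image_iff)
    fix i j assume "i \<in> cells G \<times> cells H" "j \<in> cells G \<times> cells H"
    then show "((case i of (c, d) \<Rightarrow> cell_times c d) \<subseteq> (case j of (c, d) \<Rightarrow> cell_times c d)) =
      ((case i of (c, d) \<Rightarrow> cell_times (f c) d) \<subseteq> (case j of (c, d) \<Rightarrow> cell_times (f c) d))"
      using f(2)[symmetric] imageI[of _ "cells G" f, unfolded f(1)]
      by (cases i; cases j)
        (simp add: cell_times_subset_iff[OF assms(1,3)] cell_times_subset_iff[OF assms(2,3)])
  qed (auto simp: cells_append image_iff)
qed

text \<open>All one-point complexes are isomorphic, so the choice of the vertex is immaterial.\<close>

definition point_complex :: "'v set set list" where
  "point_complex = [{{undefined}}]"

lemma cells_point_complex: "cells point_complex = {{[undefined]}}"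
proof -
  have *: "xs \<in> listset point_complex \<longleftrightarrow> xs = [{undefined}]" for xs
    by (auto simp: listset_iff point_complex_def list_all2_Cons2)
  show ?thesis unfolding cells_def * by simp
qed

lemma product_complex_point: "product_complex point_complex"
  by (auto simp: point_complex_def product_complex_def simplicial_complex_def)

lemma isomorphic_point_append:
  assumes "product_complex G"
  shows "isomorphic_complexes (point_complex @ G) G"
proof (rule isomorphic_complexesI[where I = "cells G"
      and p = "cell_times {[undefined]}" and q = "\<lambda>c. c"])
  fix i j assume "i \<in> cells G" "j \<in> cells G"
  then show "cell_times {[undefined]} i \<subseteq> cell_times {[undefined]} j \<longleftrightarrow> i \<subseteq> j"
    by (simp add: cell_times_subset_iff[OF product_complex_point assms] cells_point_complex)
qed (auto simp: cells_append cells_point_complex)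


section \<open>Components of products\<close>

lemma sym_incident: "sym ((incident P)\<^sup>*)"
  by (rule sym_rtrancl) (auto simp: sym_def incident_def)

lemma incident_rtrancl_mem: "(x, y) \<in> (incident P)\<^sup>* \<Longrightarrow> x \<in> P \<Longrightarrow> y \<in> P"
  by (induction rule: rtrancl_induct) (auto simp: incident_def)

lemma componentE:
  assumes "C \<in> components P"
  obtains x where "x \<in> P" "C = (incident P)\<^sup>* `` {x}"
  using assms unfolding components_def by (auto elim: quotientE)

lemma component_subset: "C \<in> components P \<Longrightarrow> C \<subseteq> P"
  by (auto elim!: componentE dest: incident_rtrancl_mem)

lemma component_nonempty: "C \<in> components P \<Longrightarrow> C \<noteq> {}"
  by (auto elim!: componentE)

lemma component_closed:
  assumes "C \<in> components P" "x \<in> C" "(x, y) \<in> incident P"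
  shows "y \<in> C"
  using assms by (auto elim!: componentE intro: rtrancl_into_rtrancl)

lemma component_of_mem:
  assumes "C \<in> components P" "x \<in> C"
  shows "C = (incident P)\<^sup>* `` {x}"
proof -
  obtain z where z: "C = (incident P)\<^sup>* `` {z}"
    using assms(1) by (rule componentE)
  then have "(z, x) \<in> (incident P)\<^sup>*" "(x, z) \<in> (incident P)\<^sup>*"
    using assms(2) sym_incident[of P] by (auto dest: symD)
  then show ?thesis
    unfolding z by (auto intro: rtrancl_trans)
qed

lemma components_disjoint:
  assumes "C \<in> components P" "D \<in> components P" "x \<in> C" "x \<in> D"
  shows "C = D"
  using assms component_of_mem by metis

lemma Union_components: "\<Union> (components P) = P"
proof
  show "\<Union> (components P) \<subseteq> P" using component_subset by blast
  show "P \<subseteq> \<Union> (components P)" unfolding components_def quotient_def by blast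
qed

lemma finite_components: "finite P \<Longrightarrow> finite (components P)"
  by (metis Union_components finite_UnionD)

lemma components_component:
  assumes "C \<in> components P"
  shows "components C = {C}"
proof -
  have path: "y \<in> C \<and> (x, y) \<in> (incident C)\<^sup>*" if "(x, y) \<in> (incident P)\<^sup>*" "x \<in> C" for x y
    using that
  proof (induction rule: rtrancl_induct)
    case (step y z)
    then have "z \<in> C" using component_closed assms by metis
    then have "(y, z) \<in> incident C" using step by (auto simp: incident_def)
    with step \<open>z \<in> C\<close> show ?case by auto
  qed auto
  have "(incident C)\<^sup>* `` {x} = C" if "x \<in> C" for x
    using that path component_of_mem[OF assms that] incident_rtrancl_mem[of x _ C] by blast
  then show ?thesis
    unfolding components_def quotient_def using component_nonempty[OF assms] by auto
qed

definition cellset_times :: "'v list set set \<Rightarrow> 'v list set set \<Rightarrow> 'v list set set" where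
  "cellset_times C D = {cell_times c d | c d. c \<in> C \<and> d \<in> D}"

lemma cells_append': "cells (G @ H) = cellset_times (cells G) (cells H)"
  by (simp add: cells_append cellset_times_def)

lemma incident_rtrancl_cell_times:
  assumes G: "product_complex G" and H: "product_complex H"
    and c: "c \<in> cells G" and d: "d \<in> cells H"
  shows "(incident (cells (G @ H)))\<^sup>* `` {cell_times c d} =
    cellset_times ((incident (cells G))\<^sup>* `` {c}) ((incident (cells H))\<^sup>* `` {d})"
    (is "?L = ?R")
proof
  have "z \<in> ?R" if "(cell_times c d, z) \<in> (incident (cells (G @ H)))\<^sup>*" for z
    using that
  proof (induction rule: rtrancl_induct)
    case base
    show ?case by (auto simp: cellset_times_def)
  next
    case (step y z)
    obtain c1 d1 where y: "y = cell_times c1 d1" and c1: "(c, c1) \<in> (incident (cells G))\<^sup>*"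
      and d1: "(d, d1) \<in> (incident (cells H))\<^sup>*"
      using step.IH by (auto simp: cellset_times_def)
    have m1: "c1 \<in> cells G" "d1 \<in> cells H"
      using c d c1 d1 incident_rtrancl_mem by metis+
    obtain c2 d2 where z: "z = cell_times c2 d2" and m2: "c2 \<in> cells G" "d2 \<in> cells H"
      using step.hyps(2) by (auto simp: incident_def cells_append)
    have "(c1, c2) \<in> incident (cells G)" "(d1, d2) \<in> incident (cells H)"
      using step.hyps(2) m1 m2 cell_times_subset_iff[OF G H]
      by (auto simp: incident_def y z)
    then show ?case
      using c1 d1 unfolding z cellset_times_def by (blast intro: rtrancl_into_rtrancl)
  qed
  then show "?L \<subseteq> ?R" by blast
next
  let ?r = "incident (cells (G @ H))"
  have left: "(cell_times c d, cell_times c1 d) \<in> ?r\<^sup>*"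
    if "(c, c1) \<in> (incident (cells G))\<^sup>*" for c1
    using that
  proof (induction rule: rtrancl_induct)
    case (step y z)
    have "(cell_times y d, cell_times z d) \<in> ?r"
      using step.hyps(2) d by (auto simp: incident_def cells_append cell_times_def)
    with step show ?case by auto
  qed auto
  have right: "(cell_times c1 d, cell_times c1 d1) \<in> ?r\<^sup>*"
    if "(d, d1) \<in> (incident (cells H))\<^sup>*" "c1 \<in> cells G" for c1 d1
    using that
  proof (induction rule: rtrancl_induct)
    case (step y z)
    have "(cell_times c1 y, cell_times c1 z) \<in> ?r"
      using step.hyps(2) step.prems by (auto simp: incident_def cells_append cell_times_def)
    with step show ?case by auto
  qed auto
  show "?R \<subseteq> ?L"
  proof
    fix z assume "z \<in> ?R"
    then obtain c1 d1 where z: "z = cell_times c1 d1" and c1: "(c, c1) \<in> (incident (cells G))\<^sup>*"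
      and d1: "(d, d1) \<in> (incident (cells H))\<^sup>*"
      by (auto simp: cellset_times_def)
    have "(cell_times c1 d, z) \<in> ?r\<^sup>*"
      unfolding z by (rule right[OF d1 incident_rtrancl_mem[OF c1 c]])
    with left[OF c1] show "z \<in> ?L"
      by (auto intro: rtrancl_trans)
  qed
qed

lemma components_append:
  assumes "product_complex G" "product_complex H"
  shows "components (cells (G @ H)) =
    {cellset_times C D | C D. C \<in> components (cells G) \<and> D \<in> components (cells H)}"
proof -
  define r where "r = (incident (cells (G @ H)))\<^sup>*"
  have "components (cells (G @ H)) = (\<lambda>z. r `` {z}) ` cells (G @ H)"
    unfolding components_def quotient_def r_def by blast
  also have "\<dots> = {r `` {cell_times c d} | c d. c \<in> cells G \<and> d \<in> cells H}"
    unfolding cells_append by blast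
  also have "\<dots> = {cellset_times ((incident (cells G))\<^sup>* `` {c}) ((incident (cells H))\<^sup>* `` {d})
      | c d. c \<in> cells G \<and> d \<in> cells H}"
    unfolding r_def using incident_rtrancl_cell_times[OF assms] by (intro Collect_cong) metis
  also have "\<dots> = {cellset_times C D | C D. C \<in> components (cells G) \<and> D \<in> components (cells H)}"
    unfolding components_def quotient_def by blast
  finally show ?thesis .
qed

lemma cellset_times_inject:
  assumes "product_complex G" "product_complex H"
    and "C \<subseteq> cells G" "D \<subseteq> cells H" "C' \<subseteq> cells G" "D' \<subseteq> cells H"
    and "C \<noteq> {}" "D \<noteq> {}" "C' \<noteq> {}" "D' \<noteq> {}"
    and eq: "cellset_times C D = cellset_times C' D'"
  shows "C = C' \<and> D = D'"
proof -
  have sub: "C \<subseteq> C' \<and> D \<subseteq> D'"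
    if le: "C \<subseteq> cells G" "D \<subseteq> cells H" "C' \<subseteq> cells G" "D' \<subseteq> cells H"
      and "C \<noteq> {}" "D \<noteq> {}"
      and "cellset_times C D \<subseteq> cellset_times C' D'" for C D C' D'
  proof -
    have "c \<in> C' \<and> d \<in> D'" if cd: "c \<in> C" "d \<in> D" for c d
    proof -
      have "cell_times c d \<in> cellset_times C' D'"
        using \<open>cellset_times C D \<subseteq> _\<close> cd unfolding cellset_times_def by blast
      then obtain c' d' where c'd': "cell_times c d = cell_times c' d'" "c' \<in> C'" "d' \<in> D'"
        by (auto simp: cellset_times_def)
      then have "c = c' \<and> d = d'"
        using cell_times_eq_iff[OF assms(1,2)] le cd by blast
      with c'd' show ?thesis by simp
    qed
    then show ?thesis using that by blast
  qed
  show ?thesis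
    using sub[of C D C' D'] sub[of C' D' C D] assms by blast
qed

lemma component_single:
  assumes A: "simplicial_complex A" and C: "C \<in> components (cells [A])"
  shows "\<exists>H. product_complex H \<and> cells H = C"
proof -
  have ls: "xs \<in> listset [B] \<longleftrightarrow> (\<exists>x\<in>B. xs = [x])" for xs and B :: "'a set set"
    by (auto simp: listset_iff list_all2_Cons2)
  have cells1: "cells [B] = {listset [x] | x. x \<in> B}" for B :: "'a set set"
    unfolding cells_def ls by blast
  define B where "B = {x \<in> A. listset [x] \<in> C}"
  have B: "y \<in> B" if "x \<in> B" "y \<subseteq> x" "y \<noteq> {}" for x y
  proof -
    have "x \<in> A" "y \<in> A"
      using that A by (auto simp: B_def simplicial_complex_def)
    moreover have "listset [y] \<subseteq> listset [x]"
      using that(2) by auto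
    ultimately have "(listset [x], listset [y]) \<in> incident (cells [A])"
      unfolding incident_def cells1 by blast
    then have "listset [y] \<in> C"
      using component_closed[OF C] that(1) by (auto simp: B_def)
    with \<open>y \<in> A\<close> show ?thesis by (simp add: B_def)
  qed
  have "B \<subseteq> A" by (auto simp: B_def)
  with A have "finite B \<and> (\<forall>x\<in>B. finite x \<and> x \<noteq> {})"
    unfolding simplicial_complex_def by (meson finite_subset subsetD)
  with B have "simplicial_complex B"
    unfolding simplicial_complex_def by blast
  moreover have "cells [B] = C"
    using component_subset[OF C] unfolding cells1 B_def by blast
  ultimately show ?thesis
    by (intro exI[of _ "[B]"]) (simp add: product_complex_def)
qed

lemma component_product_complex:
  assumes "product_complex G" "C \<in> components (cells G)"
  shows "\<exists>H. product_complex H \<and> cells H = C"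
proof -
  have "G \<noteq> []" using assms(1) by (simp add: product_complex_def)
  then show ?thesis
    using assms
  proof (induction G arbitrary: C rule: list_nonempty_induct)
    case (single A)
    then show ?case
      using component_single by (auto simp: product_complex_def)
  next
    case (cons A G)
    have A: "product_complex [A]" and G: "product_complex G"
      using cons by (auto simp: product_complex_def)
    obtain C1 C2 where C: "C = cellset_times C1 C2" "C1 \<in> components (cells [A])"
      "C2 \<in> components (cells G)"
      using cons.prems(2) components_append[OF A G] by auto
    obtain H2 where H2: "product_complex H2" "cells H2 = C2"
      using cons.IH[OF G C(3)] by blast
    obtain H1 where "product_complex H1" "cells H1 = C1"
      using component_single C(2) A by (metis product_complex_def list.set_intros(1))
    with H2 show ?case
      using product_complex_append cells_append' C(1) by metis
  qed
qed


section \<open>The strong ring\<close>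

lemma signed_complex_simps [simp]:
  "signed_complex {#}"
  "signed_complex (X + Y) \<longleftrightarrow> signed_complex X \<and> signed_complex Y"
  "signed_complex (add_mset (s, G) X) \<longleftrightarrow> s \<in> {1, -1} \<and> product_complex G \<and> signed_complex X"
  by (auto simp: signed_complex_def)

lemma signed_complex_sum:
  "(\<And>i. i \<in> I \<Longrightarrow> signed_complex (f i)) \<Longrightarrow> signed_complex (\<Sum>i\<in>I. f i)"
  by (induction I rule: infinite_finite_induct) auto

lemma signed_complex_induct [consumes 1, case_names empty add]:
  assumes "signed_complex X" "P {#}"
    and "\<And>s G X. s \<in> {1, -1} \<Longrightarrow> product_complex G \<Longrightarrow> signed_complex X \<Longrightarrow> P X \<Longrightarrow>
      P ({#(s, G)#} + X)"
  shows "P X"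
  using assms(1)
proof (induction X)
  case (add x X)
  then show ?case using assms(3) by (cases x) auto
qed (use assms(2) in simp)

lemma signed_neg_simps [simp]:
  "signed_neg {#} = {#}"
  "signed_neg (X + Y) = signed_neg X + signed_neg Y"
  "signed_neg (add_mset (s, G) X) = add_mset (- s, G) (signed_neg X)"
  by (auto simp: signed_neg_def)

lemma signed_neg_sum: "signed_neg (\<Sum>i\<in>I. f i) = (\<Sum>i\<in>I. signed_neg (f i))"
  by (induction I rule: infinite_finite_induct) auto

lemma signed_complex_neg [simp]: "signed_complex X \<Longrightarrow> signed_complex (signed_neg X)"
  by (auto simp: signed_complex_def signed_neg_def)

lemma signed_times_simps [simp]:
  "signed_times {#} Y = {#}"
  "signed_times X {#} = {#}"
  "signed_times (X + X') Y = signed_times X Y + signed_times X' Y"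
  "signed_times X (Y + Y') = signed_times X Y + signed_times X Y'"
  "signed_times {#(s, G)#} {#(t, H)#} = {#(s * t, G @ H)#}"
proof -
  show "signed_times X {#} = {#}" "signed_times X (Y + Y') = signed_times X Y + signed_times X Y'"
    by (induction X) (auto simp: signed_times_def)
qed (auto simp: signed_times_def)

lemma signed_times_sum: "signed_times (\<Sum>i\<in>I. f i) Y = (\<Sum>i\<in>I. signed_times (f i) Y)"
  by (induction I rule: infinite_finite_induct) auto

lemma multiset_union_induct [case_names empty union]:
  assumes "P {#}" "\<And>x X. P X \<Longrightarrow> P ({#x#} + X)"
  shows "P X"
  using assms by (induction X) auto

lemma signed_times_neg: "signed_times (signed_neg X) Y = signed_neg (signed_times X Y)"
proof (induction X rule: multiset_union_induct)
  case (union x X)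
  obtain s G where x: "x = (s, G)" by (cases x)
  have "signed_times {#(- s, G)#} Y = signed_neg (signed_times {#(s, G)#} Y)"
    by (simp add: signed_times_def signed_neg_def image_mset.compositionality o_def
        case_prod_unfold)
  with union show ?case
    by (simp only: x signed_times_simps signed_neg_simps)
qed simp

lemma signed_complex_times [simp]:
  "signed_complex X \<Longrightarrow> signed_complex Y \<Longrightarrow> signed_complex (signed_times X Y)"
  by (fastforce simp: signed_complex_def signed_times_def product_complex_append)

lemma signed_times_assoc:
  "signed_times (signed_times X Y) Z = signed_times X (signed_times Y Z)"
proof (induction X rule: multiset_union_induct)
  case (union x X)
  have "signed_times (signed_times {#x#} Y) Z = signed_times {#x#} (signed_times Y Z)"
  proof (induction Y rule: multiset_union_induct)
    case (union y Y)
    have "signed_times (signed_times {#x#} {#y#}) Z = signed_times {#x#} (signed_times {#y#} Z)"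
    proof (induction Z rule: multiset_union_induct)
      case (union z Z)
      have "signed_times (signed_times {#x#} {#y#}) {#z#} =
          signed_times {#x#} (signed_times {#y#} {#z#})"
        by (cases x; cases y; cases z) (simp add: mult.assoc)
      with union show ?case by (simp only: signed_times_simps)
    qed simp
    with union show ?case by (simp only: signed_times_simps)
  qed simp
  with union show ?case by (simp only: signed_times_simps)
qed simp

lemma components_enum_finite:
  "product_complex G \<Longrightarrow> bij_betw cells Hs (components (cells G)) \<Longrightarrow> finite Hs"
  using finite_components[OF finite_cells] bij_betw_finite by blast

lemma components_enum_exists:
  assumes "product_complex G"
  obtains Hs where "\<forall>H\<in>Hs. product_complex H" "bij_betw cells Hs (components (cells G))"
proof -
  define h where "h C = (SOME H. product_complex H \<and> cells H = C)" for C :: "'a list set set"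
  have h: "product_complex (h C) \<and> cells (h C) = C" if "C \<in> components (cells G)" for C
    unfolding h_def using component_product_complex[OF assms that] by (rule someI_ex)
  show thesis
  proof
    show "\<forall>H\<in>h ` components (cells G). product_complex H" using h by blast
    show "bij_betw cells (h ` components (cells G)) (components (cells G))"
      using h by (auto simp: bij_betw_def inj_on_def image_image)
  qed
qed

lemma strong_eq_signed: "strong_eq X Y \<Longrightarrow> signed_complex X \<and> signed_complex Y"
  by (induction rule: strong_eq.induct) (auto intro!: signed_complex_sum)

lemma strong_eq_refl_iff: "strong_eq X X \<longleftrightarrow> signed_complex X"
  using strong_eq_signed strong_eq.refl by blast

lemma strong_eq_add:
  assumes "strong_eq X X'" "strong_eq Y Y'"
  shows "strong_eq (X + Y) (X' + Y')"
proof -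
  have "strong_eq (X + Y) (X' + Y)" "strong_eq (Y + X') (Y' + X')"
    using strong_eq.add assms strong_eq_signed by blast+
  then show ?thesis
    by (metis add.commute strong_eq.trans)
qed

lemma strong_eq_sum:
  "(\<And>i. i \<in> I \<Longrightarrow> strong_eq (f i) (g i)) \<Longrightarrow> strong_eq (\<Sum>i\<in>I. f i) (\<Sum>i\<in>I. g i)"
  by (induction I rule: infinite_finite_induct) (auto intro: strong_eq_add strong_eq.refl)

lemma strong_eq_neg: "strong_eq X Y \<Longrightarrow> strong_eq (signed_neg X) (signed_neg Y)"
proof (induction rule: strong_eq.induct)
  case (split s G Hs)
  then show ?case
    using strong_eq.split[of "- s" G Hs] by (auto simp: signed_neg_sum)
next
  case (cancel X)
  then show ?case
    using strong_eq.cancel[of "signed_neg X"] by simp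
next
  case (trans X Y W)
  then show ?case by (blast intro: strong_eq.trans)
next
  case (iso s G H)
  then show ?case using strong_eq.iso[of "- s" G H] by auto
next
  case (sym X Y)
  then show ?case by (blast intro: strong_eq.sym)
next
  case (add X Y W)
  then show ?case using strong_eq.add[OF add.IH, of "signed_neg W"] by simp
qed (simp add: strong_eq.refl)

lemma strong_eq_split_times:
  assumes s: "s \<in> {1, -1}" and G: "product_complex G" and Hs: "\<forall>H\<in>Hs. product_complex H"
    and bij: "bij_betw cells Hs (components (cells G))" and K: "product_complex K"
  shows "strong_eq {#(s, G @ K)#} (\<Sum>H\<in>Hs. {#(s, H @ K)#})"
proof -
  obtain Ks where Ks: "\<forall>K'\<in>Ks. product_complex K'" "bij_betw cells Ks (components (cells K))"
    using components_enum_exists[OF K] by blast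
  have sub: "cells H \<subseteq> cells G \<and> cells H \<noteq> {}" if "H \<in> Hs" for H
    by (intro conjI component_subset component_nonempty)
      (rule bij_betw_apply[OF bij that])+
  have sub': "cells K' \<subseteq> cells K \<and> cells K' \<noteq> {}" if "K' \<in> Ks" for K'
    by (intro conjI component_subset component_nonempty)
      (rule bij_betw_apply[OF Ks(2) that])+
  have inj: "inj_on cells Hs" "inj_on cells Ks"
    using bij Ks(2) by (auto simp: bij_betw_def)
  have cells_inj: "H1 = H2 \<and> K1 = K2"
    if "H1 \<in> Hs" "H2 \<in> Hs" "K1 \<in> Ks" "K2 \<in> Ks" "cells (H1 @ K1) = cells (H2 @ K2)" for H1 H2 K1 K2
  proof -
    have "cells H1 = cells H2 \<and> cells K1 = cells K2"
      using cellset_times_inject[OF G K] sub sub' that unfolding cells_append' by metis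
    then show ?thesis using inj that by (simp add: inj_on_def)
  qed
  define App where "App = (\<lambda>(H :: 'a set set list, K' :: 'a set set list). H @ K')"
  have cells_app_inj: "inj_on (cells \<circ> App) (Hs \<times> Ks)"
  proof (rule inj_onI)
    fix p q assume "p \<in> Hs \<times> Ks" "q \<in> Hs \<times> Ks" "(cells \<circ> App) p = (cells \<circ> App) q"
    then show "p = q"
      using cells_inj[of "fst p" "fst q" "snd p" "snd q"]
      by (auto simp: App_def case_prod_unfold prod_eq_iff)
  qed
  then have app_inj: "inj_on App (Hs \<times> Ks)" and app_cells_inj: "inj_on cells (App ` (Hs \<times> Ks))"
    by (auto intro: inj_on_imageI2 inj_on_imageI)
  have "cells ` App ` (Hs \<times> Ks) =
      (\<lambda>(C, D). cellset_times C D) ` (cells ` Hs \<times> cells ` Ks)"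
    by (auto simp: App_def cells_append' image_comp case_prod_unfold intro!: rev_image_eqI)
  also have "\<dots> = {cellset_times C D | C D. C \<in> cells ` Hs \<and> D \<in> cells ` Ks}"
    by blast
  also have "\<dots> = components (cells (G @ K))"
    using bij Ks(2) components_append[OF G K] by (simp add: bij_betw_def)
  finally have "bij_betw cells (App ` (Hs \<times> Ks)) (components (cells (G @ K)))"
    using app_cells_inj by (simp add: bij_betw_def)
  then have "strong_eq {#(s, G @ K)#} (\<Sum>L\<in>App ` (Hs \<times> Ks). {#(s, L)#})"
    using Hs Ks(1) by (intro strong_eq.split s product_complex_append G K)
      (auto simp: App_def intro: product_complex_append)
  also have "(\<Sum>L\<in>App ` (Hs \<times> Ks). {#(s, L)#}) = (\<Sum>H\<in>Hs. \<Sum>K'\<in>Ks. {#(s, H @ K')#})"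
    unfolding sum.reindex[OF app_inj] by (simp add: sum.cartesian_product App_def case_prod_unfold)
  finally have 1: "strong_eq {#(s, G @ K)#} (\<Sum>H\<in>Hs. \<Sum>K'\<in>Ks. {#(s, H @ K')#})" .
  have 2: "strong_eq {#(s, H @ K)#} (\<Sum>K'\<in>Ks. {#(s, H @ K')#})" if "H \<in> Hs" for H
  proof -
    have H: "product_complex H" using that Hs by blast
    have "components (cells H) = {cells H}"
      by (rule components_component[OF bij_betw_apply[OF bij that]])
    then have comps: "components (cells (H @ K)) = {cellset_times (cells H) D | D. D \<in> cells ` Ks}"
      using components_append[OF H K] Ks(2) by (auto simp: bij_betw_def)
    have app_inj': "inj_on ((@) H) Ks"
      by (simp add: inj_on_def)
    have "bij_betw cells ((@) H ` Ks) (components (cells (H @ K)))"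
      unfolding comps bij_betw_def
    proof
      show "inj_on cells ((@) H ` Ks)"
        using cells_inj[OF that that] by (auto simp: inj_on_def)
      show "cells ` (@) H ` Ks = {cellset_times (cells H) D | D. D \<in> cells ` Ks}"
        by (auto simp: cells_append' image_iff)
    qed
    then have "strong_eq {#(s, H @ K)#} (\<Sum>L\<in>(@) H ` Ks. {#(s, L)#})"
      using H Ks(1) by (intro strong_eq.split s product_complex_append K)
        (auto intro: product_complex_append)
    then show ?thesis by (simp add: sum.reindex[OF app_inj'])
  qed
  show ?thesis
    by (rule strong_eq.trans[OF 1 strong_eq.sym[OF strong_eq_sum[OF 2]]])
qed

lemma strong_eq_times_right:
  "strong_eq X Y \<Longrightarrow> signed_complex Z \<Longrightarrow> strong_eq (signed_times X Z) (signed_times Y Z)"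
proof (induction rule: strong_eq.induct)
  case (iso s G H)
  from \<open>signed_complex Z\<close> show ?case
  proof (induction rule: signed_complex_induct)
    case (add t K Z)
    have "strong_eq {#(s * t, G @ K)#} {#(s * t, H @ K)#}"
      using iso add by (intro strong_eq.iso product_complex_append isomorphic_append_right) auto
    from strong_eq_add[OF this add.IH] show ?case
      by (simp only: signed_times_simps)
  qed (simp add: strong_eq.refl)
next
  case (split s G Hs)
  from \<open>signed_complex Z\<close> show ?case
  proof (induction rule: signed_complex_induct)
    case (add t K Z)
    have "strong_eq {#(s * t, G @ K)#} (\<Sum>H\<in>Hs. {#(s * t, H @ K)#})"
      using split add by (intro strong_eq_split_times) auto
    from strong_eq_add[OF this add.IH] show ?case
      by (simp only: signed_times_simps signed_times_sum)
  qed (simp add: strong_eq.refl)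
next
  case (cancel X)
  then show ?case
    using strong_eq.cancel[of "signed_times X Z"] by (simp add: signed_times_neg)
next
  case (trans X Y W)
  then show ?case by (blast intro: strong_eq.trans)
next
  case (sym X Y)
  then show ?case by (blast intro: strong_eq.sym)
next
  case (add X Y W)
  then show ?case using strong_eq.add[OF add.IH[OF add.prems], of "signed_times W Z"] by simp
qed (simp add: strong_eq.refl)

lemma strong_eq_times_commute:
  assumes "signed_complex X" "signed_complex Y"
  shows "strong_eq (signed_times X Y) (signed_times Y X)"
  using assms(1)
proof (induction rule: signed_complex_induct)
  case (add s G X)
  from assms(2) have "strong_eq (signed_times {#(s, G)#} Y) (signed_times Y {#(s, G)#})"
  proof (induction rule: signed_complex_induct)
    case (add t H Y)
    have "strong_eq {#(s * t, G @ H)#} {#(s * t, H @ G)#}"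
      using add \<open>s \<in> _\<close> \<open>product_complex G\<close>
      by (intro strong_eq.iso product_complex_append isomorphic_append_commute) auto
    then have "strong_eq {#(s * t, G @ H)#} {#(t * s, H @ G)#}"
      by (simp add: mult.commute)
    from strong_eq_add[OF this add.IH] show ?case
      by (simp only: signed_times_simps)
  qed (simp add: strong_eq.refl)
  from strong_eq_add[OF this add.IH] show ?case
    by (simp only: signed_times_simps)
qed (simp add: strong_eq.refl)

lemma strong_eq_times:
  assumes "strong_eq X X'" "strong_eq Y Y'"
  shows "strong_eq (signed_times X Y) (signed_times X' Y')"
proof -
  note [trans] = strong_eq.trans
  have sc: "signed_complex X" "signed_complex X'" "signed_complex Y" "signed_complex Y'"
    using assms strong_eq_signed by blast+
  have "strong_eq (signed_times X Y) (signed_times X' Y)"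
    by (rule strong_eq_times_right[OF assms(1) sc(3)])
  also have "strong_eq \<dots> (signed_times Y X')"
    by (rule strong_eq_times_commute[OF sc(2,3)])
  also have "strong_eq \<dots> (signed_times Y' X')"
    by (rule strong_eq_times_right[OF assms(2) sc(2)])
  also have "strong_eq \<dots> (signed_times X' Y')"
    by (rule strong_eq_times_commute[OF sc(4,2)])
  finally show ?thesis .
qed

definition signed_one :: "'v signed" where
  "signed_one = {#(1, point_complex)#}"

lemma signed_complex_one: "signed_complex signed_one"
  by (simp add: signed_one_def product_complex_point)

lemma strong_eq_one_times:
  "signed_complex X \<Longrightarrow> strong_eq (signed_times signed_one X) X"
proof (induction rule: signed_complex_induct)
  case (add s G X)
  have "strong_eq {#(1 * s, point_complex @ G)#} {#(s, G)#}"
    unfolding mult_1_left using add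
    by (intro strong_eq.iso product_complex_append product_complex_point isomorphic_point_append)
  from strong_eq_add[OF this add.IH] show ?case
    by (simp only: signed_times_simps signed_one_def)
qed (simp add: strong_eq.refl)

text \<open>The signed number of cells is an invariant separating zero from one.\<close>

definition signed_card :: "'v signed \<Rightarrow> int" where
  "signed_card X = (\<Sum>(s, G)\<in>#X. s * int (card (cells G)))"

lemma signed_card_simps [simp]:
  "signed_card {#} = 0"
  "signed_card (X + Y) = signed_card X + signed_card Y"
  "signed_card {#(s, G)#} = s * int (card (cells G))"
  by (auto simp: signed_card_def)

lemma signed_card_neg: "signed_card (signed_neg X) = - signed_card X"
  by (induction X) (auto simp: signed_card_def signed_neg_def)

lemma signed_card_sum: "signed_card (\<Sum>i\<in>I. f i) = (\<Sum>i\<in>I. signed_card (f i))"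
  by (induction I rule: infinite_finite_induct) auto

lemma strong_eq_signed_card: "strong_eq X Y \<Longrightarrow> signed_card X = signed_card Y"
proof (induction rule: strong_eq.induct)
  case (iso s G H)
  then show ?case
    by (auto simp: isomorphic_complexes_def dest: bij_betw_same_card)
next
  case (split s G Hs)
  have fin: "finite (cells G)" by (rule finite_cells[OF split.hyps(2)])
  have "card (cells G) = card (\<Union> (components (cells G)))"
    by (simp add: Union_components)
  also have "\<dots> = (\<Sum>C\<in>components (cells G). card C)"
  proof (rule card_Union_disjoint)
    show "pairwise disjnt (components (cells G))"
      unfolding pairwise_def disjnt_def using components_disjoint by blast
    show "finite C" if "C \<in> components (cells G)" for C
      using component_subset[OF that] fin by (rule finite_subset)
  qed
  also have "\<dots> = (\<Sum>H\<in>Hs. card (cells H))"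
    by (rule sum.reindex_bij_betw[OF split.hyps(4), symmetric])
  finally show ?case
    by (simp add: signed_card_sum sum_distrib_left)
qed (auto simp: signed_card_neg)

quotient_type 'v strong_ring = "'v signed" / partial: strong_eq
proof (rule part_equivpI)
  show "\<exists>X :: 'v signed. strong_eq X X"
    using strong_eq.refl signed_complex_simps(1) by blast
  show "symp (strong_eq :: 'v signed \<Rightarrow> 'v signed \<Rightarrow> bool)"
    by (rule sympI) (rule strong_eq.sym)
  show "transp (strong_eq :: 'v signed \<Rightarrow> 'v signed \<Rightarrow> bool)"
    by (rule transpI) (rule strong_eq.trans)
qed

instantiation strong_ring :: (type) comm_ring_1
begin

lift_definition zero_strong_ring :: "'v strong_ring" is "{#}"
  by (simp add: strong_eq_refl_iff)

lift_definition one_strong_ring :: "'v strong_ring" is signed_one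
  by (simp add: strong_eq_refl_iff signed_complex_one)

lift_definition plus_strong_ring :: "'v strong_ring \<Rightarrow> 'v strong_ring \<Rightarrow> 'v strong_ring" is "(+)"
  by (rule strong_eq_add)

lift_definition uminus_strong_ring :: "'v strong_ring \<Rightarrow> 'v strong_ring" is signed_neg
  by (rule strong_eq_neg)

lift_definition times_strong_ring :: "'v strong_ring \<Rightarrow> 'v strong_ring \<Rightarrow> 'v strong_ring"
  is signed_times
  by (rule strong_eq_times)

definition minus_strong_ring :: "'v strong_ring \<Rightarrow> 'v strong_ring \<Rightarrow> 'v strong_ring" where
  "minus_strong_ring a b = a + - b"

instance
proof
  fix a b c :: "'v strong_ring"
  show "a * b * c = a * (b * c)"
    by transfer (simp add: signed_times_assoc strong_eq_refl_iff)
  show "a * b = b * a"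
    by transfer (simp add: strong_eq_refl_iff strong_eq_times_commute)
  show "1 * a = a"
    by transfer (simp add: strong_eq_refl_iff strong_eq_one_times)
  show "a + b + c = a + (b + c)"
    by transfer (simp add: add.assoc strong_eq_refl_iff)
  show "a + b = b + a"
    by transfer (simp add: add.commute strong_eq_refl_iff)
  show "0 + a = a"
    by transfer simp
  show "- a + a = 0"
    by transfer (simp add: add.commute strong_eq_refl_iff strong_eq.cancel)
  show "a - b = a + - b"
    by (rule minus_strong_ring_def)
  show "(a + b) * c = a * c + b * c"
    by transfer (simp add: strong_eq_refl_iff)
  show "(0 :: 'v strong_ring) \<noteq> 1"
  proof
    assume "(0 :: 'v strong_ring) = 1"
    then have "strong_eq {#} (signed_one :: 'v signed)"
      by transfer
    from strong_eq_signed_card[OF this] show False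
      by (simp add: signed_one_def cells_point_complex)
  qed
qed

end

end

theory Submission
  imports Defs
begin

text \<open>
  The Euler polynomial of a product complex is the sum of \<open>t ^ dim c\<close> over its cells \<open>c\<close>
  (\<open>euler_poly_conv_cell_poly\<close>), so everything rests on how the dimension of a cell behaves.

  The dimension is intrinsic in two ways. A cell, as a set of tuples, determines its factors and
  hence its dimension, whatever complex it is regarded in; therefore splitting a complex into
  components only partitions the sum. Secondly, the dimension is strictly monotone under inclusion,
  and every cell of positive dimension has a face of dimension one less. So the dimension of \<open>c\<close> is
  the number of steps in a longest chain ending in \<open>c\<close> in the inclusion order, and isomorphisms preserve it
  (\<open>cell_dim_isomorphism\<close>). Cancellation is respected because the polynomial is additive and odd
  under sign reversal, so it is well defined on the strong ring (\<open>strong_eq_euler_poly\<close>).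

  Multiplicativity holds since the cells of a product are the pairs of cells of the factors,
  and dimensions add.
\<close>

section \<open>The dimension of a cell\<close>

lemma listset_subsetD:
  assumes "listset xs \<subseteq> listset ys" "listset xs \<noteq> {}"
  shows "list_all2 (\<subseteq>) xs ys"
  using assms
proof (induction xs arbitrary: ys)
  case Nil
  then show ?case by (simp add: listset_iff)
next
  case (Cons x xs)
  from Cons.prems(2) obtain a as where a: "a \<in> x" "as \<in> listset xs"
    by (auto simp: set_Cons_def)
  have mem: "b # bs \<in> listset ys" if "b \<in> x" "bs \<in> listset xs" for b bs
    using Cons.prems(1) that by (auto simp: set_Cons_def)
  from mem[OF a] obtain y ys' where ys: "ys = y # ys'"
    by (auto simp: listset_iff list_all2_Cons1)
  have "x \<subseteq> y" "listset xs \<subseteq> listset ys'"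
    using mem a unfolding ys by (auto simp: set_Cons_def)
  with Cons.IH[of ys'] a show ?case
    by (auto simp: ys)
qed

lemma listset_mono: "list_all2 (\<subseteq>) xs ys \<Longrightarrow> listset xs \<subseteq> listset ys"
  by (induction rule: list_all2_induct) (auto simp: set_Cons_def)

text \<open>Non-empty factors can be recovered from the product as its projections.\<close>

lemma listset_inject:
  assumes "listset xs = listset ys" "listset xs \<noteq> {}"
  shows "xs = ys"
  using listset_subsetD[of xs ys] listset_subsetD[of ys xs] assms
  by (auto intro!: list_all2_antisym[where P = "(\<subseteq>)" and Q = "(\<subseteq>)"])

text \<open>
  The choice refers to the cell alone and not to a complex containing it, so that a complex and its
  components assign the same dimension to a common cell.
\<close>

definition cell_dim :: "'v list set \<Rightarrow> nat" where
  "cell_dim c = (\<Sum>x\<leftarrow>(SOME xs. listset xs = c). simplex_dim x)"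

lemma cell_dim_listset:
  assumes "listset xs \<noteq> {}"
  shows "cell_dim (listset xs) = (\<Sum>x\<leftarrow>xs. simplex_dim x)"
proof -
  have "(SOME ys. listset ys = listset xs) = xs"
    using assms by (intro some_equality) (auto dest: listset_inject)
  then show ?thesis by (simp add: cell_dim_def)
qed

lemma cellE:
  assumes "product_complex G" "c \<in> cells G"
  obtains xs where "c = listset xs" "listset xs \<noteq> {}" "xs \<in> listset G"
    "\<forall>x\<in>set xs. finite x \<and> x \<noteq> {}"
proof -
  obtain xs where xs: "c = listset xs" "xs \<in> listset G"
    using assms(2) unfolding cells_def by blast
  moreover have "\<forall>x\<in>set xs. finite x \<and> x \<noteq> {}"
    using xs(2) assms(1) unfolding listset_iff product_complex_def simplicial_complex_def
    by (metis in_set_conv_nth list_all2_conv_all_nth nth_mem)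
  ultimately show thesis
    using cell_nonempty[OF assms] that by blast
qed

lemma sum_simplex_dim_mono:
  assumes "list_all2 (\<subseteq>) xs ys" "\<forall>x\<in>set xs. x \<noteq> {}" "\<forall>y\<in>set ys. finite y"
  shows "xs = ys \<or> (\<Sum>x\<leftarrow>xs. simplex_dim x) < (\<Sum>y\<leftarrow>ys. simplex_dim y)"
  using assms
proof (induction rule: list_all2_induct)
  case (Cons x xs y ys)
  have "x = y \<or> simplex_dim x < simplex_dim y"
  proof (cases "x = y")
    case False
    have "0 < card x" "card x < card y"
      using False Cons by (auto simp: card_gt_0_iff finite_subset intro!: psubset_card_mono)
    then show ?thesis unfolding simplex_dim_def by linarith
  qed simp
  with Cons show ?case by auto
qed simp

lemma cell_dim_strict_mono:
  assumes "product_complex G" "c \<in> cells G" "d \<in> cells G" "c \<subset> d"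
  shows "cell_dim c < cell_dim d"
proof -
  obtain xs where xs: "c = listset xs" "listset xs \<noteq> {}" "\<forall>x\<in>set xs. finite x \<and> x \<noteq> {}"
    using assms(1,2) by (rule cellE)
  obtain ys where ys: "d = listset ys" "listset ys \<noteq> {}" "\<forall>y\<in>set ys. finite y \<and> y \<noteq> {}"
    using assms(1,3) by (rule cellE)
  have "list_all2 (\<subseteq>) xs ys" "xs \<noteq> ys"
    using assms(4) xs ys listset_subsetD by blast+
  with sum_simplex_dim_mono[of xs ys] xs ys show ?thesis
    by (simp add: cell_dim_listset)
qed

text \<open>Deleting one vertex from one factor with at least two vertices gives a facet.\<close>

lemma sum_simplex_dim_facet:
  assumes "list_all2 (\<in>) xs G" "\<forall>A\<in>set G. simplicial_complex A"
    and "(\<Sum>x\<leftarrow>xs. simplex_dim x) = Suc n"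
  shows "\<exists>ys. list_all2 (\<in>) ys G \<and> list_all2 (\<subseteq>) ys xs \<and> (\<Sum>y\<leftarrow>ys. simplex_dim y) = n"
  using assms
proof (induction arbitrary: n rule: list_all2_induct)
  case (Cons x xs A G)
  show ?case
  proof (cases "simplex_dim x")
    case 0
    with Cons.prems Cons.IH[of n] obtain ys where
      "list_all2 (\<in>) ys G" "list_all2 (\<subseteq>) ys xs" "(\<Sum>y\<leftarrow>ys. simplex_dim y) = n"
      by auto
    with 0 Cons.hyps show ?thesis
      by (intro exI[of _ "x # ys"]) auto
  next
    case (Suc m)
    then have card: "card x = Suc (Suc m)"
      by (simp add: simplex_dim_def)
    then obtain a where a: "a \<in> x" by fastforce
    have fin: "finite x" using card by (intro card_ge_0_finite) simp
    have facet: "card (x - {a}) = Suc m"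
      using card a fin by simp
    have "x - {a} \<noteq> {}"
    proof
      assume "x - {a} = {}"
      then show False using facet by (metis card.empty nat.distinct(1))
    qed
    then have "x - {a} \<in> A"
      using Cons.hyps(1) Cons.prems(1) unfolding simplicial_complex_def
      by (metis Diff_subset list.set_intros(1))
    moreover have "simplex_dim (x - {a}) = m"
      using facet by (simp add: simplex_dim_def)
    moreover have "list_all2 (\<subseteq>) xs xs"
      by (simp add: list_all2_refl)
    ultimately show ?thesis
      using Cons.hyps(2) Cons.prems(2) Suc by (intro exI[of _ "(x - {a}) # xs"]) auto
  qed
qed simp

lemma cell_dim_facet:
  assumes G: "product_complex G" and "c \<in> cells G" "cell_dim c = Suc n"
  shows "\<exists>d\<in>cells G. d \<subset> c \<and> cell_dim d = n"
proof -
  obtain xs where xs: "c = listset xs" "listset xs \<noteq> {}" "xs \<in> listset G"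
    using assms(1,2) by (rule cellE)
  have "(\<Sum>x\<leftarrow>xs. simplex_dim x) = Suc n"
    using assms(3) cell_dim_listset[OF xs(2)] xs(1) by simp
  then obtain ys where ys: "ys \<in> listset G" "list_all2 (\<subseteq>) ys xs"
    "(\<Sum>y\<leftarrow>ys. simplex_dim y) = n"
    using sum_simplex_dim_facet[of xs G n] xs(3) G
    unfolding listset_iff product_complex_def by blast
  have mem: "listset ys \<in> cells G"
    using ys(1) unfolding cells_def by blast
  have dim: "cell_dim (listset ys) = n"
    using cell_dim_listset[OF cell_nonempty[OF G mem]] ys(3) by simp
  with listset_mono[OF ys(2)] assms(3) xs(1) have "listset ys \<subset> c" by auto
  with mem dim show ?thesis by blast
qed

text \<open>
  A strictly monotone map sends a longest chain below a cell to a chain, so it cannot lower the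
  dimension. Applied to an isomorphism and to its inverse this gives equality.
\<close>

lemma cell_dim_le_of_strict_mono:
  assumes G: "product_complex G" and H: "product_complex H"
    and f: "\<And>x. x \<in> cells G \<Longrightarrow> f x \<in> cells H"
    and mono: "\<And>x y. x \<in> cells G \<Longrightarrow> y \<in> cells G \<Longrightarrow> x \<subset> y \<Longrightarrow> f x \<subset> f y"
    and c: "c \<in> cells G"
  shows "cell_dim c \<le> cell_dim (f c)"
  using c
proof (induction "cell_dim c" arbitrary: c)
  case (Suc n)
  obtain d where d: "d \<in> cells G" "d \<subset> c" "cell_dim d = n"
    using cell_dim_facet[OF G Suc.prems Suc.hyps(2)[symmetric]] by blast
  have "cell_dim (f d) < cell_dim (f c)"
    using d Suc.prems by (intro cell_dim_strict_mono[OF H] f mono)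
  with Suc.hyps(1)[of d] Suc.hyps(2) d show ?case by simp
qed simp

lemma cell_dim_isomorphism:
  assumes G: "product_complex G" and H: "product_complex H"
    and bij: "bij_betw f (cells G) (cells H)"
    and le: "\<forall>x\<in>cells G. \<forall>y\<in>cells G. x \<subseteq> y \<longleftrightarrow> f x \<subseteq> f y"
    and c: "c \<in> cells G"
  shows "cell_dim (f c) = cell_dim c"
proof (rule antisym)
  have less: "x \<subset> y \<longleftrightarrow> f x \<subset> f y" if "x \<in> cells G" "y \<in> cells G" for x y
    using le that by (simp add: less_le_not_le)
  show "cell_dim c \<le> cell_dim (f c)"
    using bij_betw_apply[OF bij] less c by (intro cell_dim_le_of_strict_mono[OF G H]) auto
  define g where "g = inv_into (cells G) f"
  have g: "g y \<in> cells G" "f (g y) = y" if "y \<in> cells H" for y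
    using bij_betw_inv_into_right[OF bij that] bij_betw_apply[OF bij_betw_inv_into[OF bij] that]
    by (simp_all add: g_def)
  have "cell_dim (f c) \<le> cell_dim (g (f c))"
    using g less bij_betw_apply[OF bij c] by (intro cell_dim_le_of_strict_mono[OF H G]) auto
  then show "cell_dim (f c) \<le> cell_dim c"
    by (simp add: g_def bij_betw_inv_into_left[OF bij c])
qed

lemma cell_dim_cell_times:
  assumes G: "product_complex G" and H: "product_complex H"
    and c: "c \<in> cells G" and d: "d \<in> cells H"
  shows "cell_dim (cell_times c d) = cell_dim c + cell_dim d"
proof -
  obtain xs where xs: "c = listset xs" "listset xs \<noteq> {}"
    using G c by (rule cellE)
  obtain ys where ys: "d = listset ys" "listset ys \<noteq> {}"
    using H d by (rule cellE)
  have "cell_times c d \<in> cells (G @ H)"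
    using c d unfolding cells_append by blast
  then have "listset (xs @ ys) \<noteq> {}"
    using cell_nonempty[OF product_complex_append[OF G H]]
    unfolding listset_append_cell_times xs(1) ys(1) by blast
  then have "cell_dim (listset (xs @ ys)) = cell_dim c + cell_dim d"
    by (simp only: cell_dim_listset[OF xs(2)] cell_dim_listset[OF ys(2)] xs(1) ys(1)
        cell_dim_listset map_append sum_list.append not_False_eq_True)
  then show ?thesis
    by (simp only: listset_append_cell_times xs(1) ys(1))
qed

section \<open>The Euler polynomial as a sum over cells\<close>

text \<open>
  The argument is a set of cells rather than a list of factors, since a component is given only as a
  set of cells.
\<close>

definition cell_poly :: "'v list set set \<Rightarrow> int poly" where
  "cell_poly C = (\<Sum>c\<in>C. monom 1 (cell_dim c))"

lemma coeff_cell_poly: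
  assumes G: "product_complex G"
  shows "coeff (cell_poly (cells G)) k = int (face_number G k)"
proof -
  have dim: "cell_dim (listset xs) = (\<Sum>x\<leftarrow>xs. simplex_dim x)" if "xs \<in> listset G" for xs
    by (intro cell_dim_listset cell_nonempty[OF G]) (use that in \<open>auto simp only: cells_def\<close>)
  have "{listset xs | xs. xs \<in> listset G \<and> (\<Sum>x\<leftarrow>xs. simplex_dim x) = k} =
      {listset xs | xs. xs \<in> listset G \<and> cell_dim (listset xs) = k}"
    by (intro Collect_cong ex_cong1 conj_cong refl) (simp_all add: dim)
  also have "\<dots> = {c \<in> cells G. cell_dim c = k}"
    unfolding cells_def by blast
  finally have "face_number G k = card {c \<in> cells G. cell_dim c = k}"
    unfolding face_number_def by (rule arg_cong)
  then show ?thesis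
    using finite_cells[OF G]
    by (simp add: cell_poly_def coeff_sum sum.If_cases Int_def)
qed

lemma euler_poly_conv_cell_poly:
  assumes "signed_complex X"
  shows "euler_poly X = (\<Sum>(s, G)\<in>#X. smult s (cell_poly (cells G)))"
proof (rule poly_eqI)
  fix k
  have "signed_face_number X k = coeff (\<Sum>(s, G)\<in>#X. smult s (cell_poly (cells G))) k"
    using assms
    by (induction rule: signed_complex_induct) (auto simp: signed_face_number_def coeff_cell_poly)
  then show "coeff (euler_poly X) k = coeff (\<Sum>(s, G)\<in>#X. smult s (cell_poly (cells G))) k"
    by (simp add: coeff_euler_poly[OF assms])
qed

lemma cell_poly_isomorphic:
  assumes "product_complex G" "product_complex H" "isomorphic_complexes G H"
  shows "cell_poly (cells G) = cell_poly (cells H)"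
proof -
  from assms(3) obtain f where bij: "bij_betw f (cells G) (cells H)"
    and le: "\<forall>x\<in>cells G. \<forall>y\<in>cells G. x \<subseteq> y \<longleftrightarrow> f x \<subseteq> f y"
    unfolding isomorphic_complexes_def by (elim exE conjE)
  show ?thesis
    unfolding cell_poly_def sum.reindex_bij_betw[OF bij, symmetric]
    using cell_dim_isomorphism[OF assms(1,2) bij le] by simp
qed

lemma cell_poly_components:
  assumes "finite P"
  shows "cell_poly P = (\<Sum>C\<in>components P. cell_poly C)"
proof -
  have "\<forall>C\<in>components P. finite C"
    using assms component_subset finite_subset by blast
  moreover have "\<forall>C\<in>components P. \<forall>D\<in>components P. C \<noteq> D \<longrightarrow> C \<inter> D = {}"
    using components_disjoint by blast
  ultimately have "cell_poly (\<Union> (components P)) = (\<Sum>C\<in>components P. cell_poly C)"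
    unfolding cell_poly_def by (simp add: sum.Union_disjoint)
  then show ?thesis by (simp add: Union_components)
qed

lemma cell_poly_append:
  assumes G: "product_complex G" and H: "product_complex H"
  shows "cell_poly (cells (G @ H)) = cell_poly (cells G) * cell_poly (cells H)"
proof -
  have "bij_betw (\<lambda>(c, d). cell_times c d) (cells G \<times> cells H) (cells (G @ H))"
    unfolding bij_betw_def
  proof
    show "inj_on (\<lambda>(c, d). cell_times c d) (cells G \<times> cells H)"
      by (auto simp: inj_on_def cell_times_eq_iff[OF G H])
  qed (auto simp: cells_append image_iff)
  from sum.reindex_bij_betw[OF this, of "\<lambda>c. monom 1 (cell_dim c)"]
  have "cell_poly (cells (G @ H)) =
      (\<Sum>(c, d)\<in>cells G \<times> cells H. monom 1 (cell_dim (cell_times c d)))"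
    by (simp add: cell_poly_def case_prod_unfold eq_commute)
  also have "\<dots> = (\<Sum>(c, d)\<in>cells G \<times> cells H. monom 1 (cell_dim c) * monom 1 (cell_dim d))"
    by (intro sum.cong) (auto simp: cell_dim_cell_times[OF G H] mult_monom)
  finally show ?thesis
    by (simp add: cell_poly_def sum_product sum.cartesian_product)
qed

section \<open>The homomorphism on the strong ring\<close>

lemma euler_poly_empty: "euler_poly {#} = 0"
  by (simp add: euler_poly_conv_cell_poly)

lemma euler_poly_add:
  "signed_complex X \<Longrightarrow> signed_complex Y \<Longrightarrow> euler_poly (X + Y) = euler_poly X + euler_poly Y"
  by (simp add: euler_poly_conv_cell_poly)

lemma euler_poly_single:
  "s \<in> {1, -1} \<Longrightarrow> product_complex G \<Longrightarrow> euler_poly {#(s, G)#} = smult s (cell_poly (cells G))"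
  by (simp add: euler_poly_conv_cell_poly)

lemma euler_poly_neg: "signed_complex X \<Longrightarrow> euler_poly (signed_neg X) = - euler_poly X"
  by (induction rule: signed_complex_induct)
    (auto simp: euler_poly_empty euler_poly_conv_cell_poly)

lemma euler_poly_sum:
  "(\<And>i. i \<in> I \<Longrightarrow> signed_complex (f i)) \<Longrightarrow> euler_poly (\<Sum>i\<in>I. f i) = (\<Sum>i\<in>I. euler_poly (f i))"
  by (induction I rule: infinite_finite_induct)
    (simp_all add: euler_poly_empty euler_poly_add signed_complex_sum)

lemma euler_poly_one: "euler_poly (signed_one :: 'v signed) = 1"
proof -
  have "cell_dim {[undefined :: 'v]} = 0"
    using cell_dim_listset[of "[{undefined :: 'v}]"] by (simp add: set_Cons_def simplex_dim_def)
  then show ?thesis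
    by (simp add: signed_one_def euler_poly_single product_complex_point cell_poly_def
        cells_point_complex one_pCons monom_0)
qed

lemma euler_poly_times:
  assumes "signed_complex X" "signed_complex Y"
  shows "euler_poly (signed_times X Y) = euler_poly X * euler_poly Y"
  using assms(1)
proof (induction rule: signed_complex_induct)
  case (add s G X)
  from assms(2)
  have "euler_poly (signed_times {#(s, G)#} Y) = euler_poly {#(s, G)#} * euler_poly Y"
  proof (induction rule: signed_complex_induct)
    case (add t H Y)
    have "s * t \<in> {1, -1}" using add.hyps \<open>s \<in> {1, -1}\<close> by auto
    then have "euler_poly {#(s * t, G @ H)#} = euler_poly {#(s, G)#} * euler_poly {#(t, H)#}"
      using add.hyps \<open>s \<in> {1, -1}\<close> \<open>product_complex G\<close>
      by (simp only: euler_poly_single product_complex_append cell_poly_append)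
        (simp add: mult.commute)
    with add \<open>s \<in> {1, -1}\<close> \<open>product_complex G\<close> \<open>s * t \<in> _\<close> show ?case
      by (simp only: signed_times_simps euler_poly_add signed_complex_simps signed_complex_times
          product_complex_append distrib_left)
  qed (simp add: euler_poly_empty)
  with add assms(2) show ?case
    by (simp only: signed_times_simps euler_poly_add signed_complex_simps signed_complex_times
        distrib_right)
qed (simp add: euler_poly_empty)

lemma strong_eq_euler_poly: "strong_eq X Y \<Longrightarrow> euler_poly X = euler_poly Y"
proof (induction rule: strong_eq.induct)
  case (add X Y Z)
  then show ?case
    using strong_eq_signed[OF add.hyps(1)] by (simp add: euler_poly_add)
next
  case (iso s G H)
  then show ?case
    using cell_poly_isomorphic[of G H] by (simp only: euler_poly_single)
next
  case (split s G Hs)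
  have "cell_poly (cells G) = (\<Sum>H\<in>Hs. cell_poly (cells H))"
    unfolding cell_poly_components[OF finite_cells[OF split.hyps(2)]]
    by (rule sum.reindex_bij_betw[OF split.hyps(4), symmetric])
  moreover have "smult s (\<Sum>H\<in>Hs. cell_poly (cells H)) = (\<Sum>H\<in>Hs. smult s (cell_poly (cells H)))"
    by (rule poly_eqI) (simp add: coeff_sum sum_distrib_left)
  ultimately show ?case
    using split.hyps by (simp add: euler_poly_single euler_poly_sum)
next
  case (cancel X)
  then show ?case
    by (simp add: euler_poly_add euler_poly_neg euler_poly_empty)
qed simp_all

lift_definition euler_hom :: "'v strong_ring \<Rightarrow> int poly" is euler_poly
  by (rule strong_eq_euler_poly)

theorem proposition3:
  shows "\<exists>\<phi> :: 'v strong_ring \<Rightarrow> int poly.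
    (\<forall>X. signed_complex X \<longrightarrow> \<phi> (abs_strong_ring X) = euler_poly X) \<and>
    \<phi> 0 = 0 \<and> \<phi> 1 = 1 \<and>
    (\<forall>a b. \<phi> (a + b) = \<phi> a + \<phi> b) \<and>
    (\<forall>a b. \<phi> (a * b) = \<phi> a * \<phi> b)"
proof (intro exI[of _ euler_hom] conjI allI impI)
  show "euler_hom (abs_strong_ring X) = euler_poly X" if "signed_complex X" for X :: "'v signed"
    using that by (simp add: euler_hom.abs_eq strong_eq_refl_iff)
  show "euler_hom (0 :: 'v strong_ring) = 0"
    by transfer (rule euler_poly_empty)
  show "euler_hom (1 :: 'v strong_ring) = 1"
    by transfer (rule euler_poly_one)
  show "euler_hom (a + b) = euler_hom a + euler_hom b" for a b :: "'v strong_ring"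
    by transfer (simp add: euler_poly_add strong_eq_refl_iff)
  show "euler_hom (a * b) = euler_hom a * euler_hom b" for a b :: "'v strong_ring"
    by transfer (simp add: euler_poly_times strong_eq_refl_iff)
qed

end
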